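(* Let $F$ be any field, let $D$ be a division algebra over $F$, and let $V$ be an infinite-dimensional vector space over $D$. Then every nonzero multilinear polynomial is surjective on the $F$-algebra $\mathrm{End}_D(V)$; that is, for every $n\in\mathbb N$ and every nonzero multilinear $f\in F\langle X_1,\dots,X_n\rangle$, one has $f(\mathrm{End}_D(V))=\mathrm{End}_D(V)$.
   Context: $F\langle X_1,\dots,X_n\rangle$ is the free (associative unital) algebra over $F$. A polynomial $f\in F\langle X_1,\dots,X_n\rangle$ is multilinear if $f=\sum_{\sigma\in S_n}\lambda_\sigma X_{\sigma(1)}\cdots X_{\sigma(n)}$ for some $\lambda_\sigma\in F$. For an $F$-algebra $A$, $f(A)=\{f(a_1,\dots,a_n)\mid a_1,\dots,a_n\in A\}$, and $f$ is surjective on $A$ if $f(A)=A$. *)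

theory Defs
  imports
    Complex_Main
    "HOL-Library.Poly_Mapping"
    "HOL-Library.Function_Algebras"
    "HOL-Combinatorics.Permutations"
begin

section \<open>The free algebra\<close>

text \<open>
  The free monoid of words over \<open>'x\<close>, written additively because the convolution
  product of \<^theory>\<open>HOL-Library.Poly_Mapping\<close> expects an additive monoid of exponents.
  Its monoid algebra \<open>'x word \<Rightarrow>\<^sub>0 'f\<close> is then the free algebra on the variables \<open>'x\<close>,
  and its ring structure is the one of the library.
\<close>

datatype 'x word = Word (letters: "'x list")

instantiation word :: (type) monoid_add
begin

definition zero_word :: "'a word" where
  "0 = Word []"

definition plus_word :: "'a word \<Rightarrow> 'a word \<Rightarrow> 'a word" where
  "v + w = Word (letters v @ letters w)"

instance
  by standard (simp_all add: zero_word_def plus_word_def)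

end

type_synonym 'f nc_poly = "nat word \<Rightarrow>\<^sub>0 'f"

definition Const :: "'f::field \<Rightarrow> 'f nc_poly" where
  "Const c = Poly_Mapping.single 0 c"

definition Var :: "nat \<Rightarrow> 'f::field nc_poly" where
  "Var i = Poly_Mapping.single (Word [i]) 1"

definition free_algebra :: "nat \<Rightarrow> 'f::field nc_poly set" where
  "free_algebra n = {f. \<forall>w\<in>Poly_Mapping.keys f. set (letters w) \<subseteq> {1..n}}"

definition multilinear :: "nat \<Rightarrow> 'f::field nc_poly \<Rightarrow> bool" where
  "multilinear n f \<longleftrightarrow>
     (\<exists>c. f = (\<Sum>\<sigma> | \<sigma> permutes {1..n}. Const (c \<sigma>) * (\<Prod>i\<leftarrow>[1..<n+1]. Var (\<sigma> i))))"

lemma monomial_eq_single: "(\<Prod>i\<leftarrow>xs. Var (\<sigma> i)) = Poly_Mapping.single (Word (map \<sigma> xs)) 1"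
  by (induction xs) (simp_all add: Var_def mult_single plus_word_def flip: single_one zero_word_def)

lemma multilinear_in_free_algebra:
  assumes "multilinear n f"
  shows "f \<in> free_algebra n"
proof -
  obtain c where f: "f = (\<Sum>\<sigma> | \<sigma> permutes {1..n}. Const (c \<sigma>) * (\<Prod>i\<leftarrow>[1..<n+1]. Var (\<sigma> i)))"
    using assms unfolding multilinear_def by blast
  have monomial: "Const (c \<sigma>) * (\<Prod>i\<leftarrow>[1..<n+1]. Var (\<sigma> i)) =
      Poly_Mapping.single (Word (map \<sigma> [1..<n+1])) (c \<sigma>)" for \<sigma>
    unfolding monomial_eq_single by (simp add: Const_def mult_single)
  have "Poly_Mapping.keys f \<subseteq>
      (\<Union>\<sigma>\<in>{\<sigma>. \<sigma> permutes {1..n}}. Poly_Mapping.keys (Poly_Mapping.single (Word (map \<sigma> [1..<n+1])) (c \<sigma>)))"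
    unfolding f monomial by (rule Poly_Mapping.keys_sum)
  also have "\<dots> \<subseteq> {w. set (letters w) \<subseteq> {1..n}}"
  proof -
    have "\<sigma> i \<in> {1..n}" if "\<sigma> permutes {1..n}" "i \<in> {1..n}" for \<sigma> i
      using that by (simp only: permutes_in_image)
    then show ?thesis by (fastforce split: if_splits)
  qed
  finally show ?thesis by (auto simp: free_algebra_def)
qed

section \<open>Algebras over a field and values of polynomials\<close>

text \<open>
  The additive structure of an algebra is that of the ambient type. In particular, for
  maps into an abelian group it is the pointwise one of
  \<^theory>\<open>HOL-Library.Function_Algebras\<close>; the multiplication, in contrast, is always
  given explicitly, and the pointwise product of functions plays no role here.
\<close>

record ('f, 'a) alg =
  carrier :: "'a set"
  scal :: "'f \<Rightarrow> 'a \<Rightarrow> 'a"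
  mul :: "'a \<Rightarrow> 'a \<Rightarrow> 'a"
  unit :: 'a

locale assoc_algebra =
  fixes A :: "('f::field, 'a::ab_group_add) alg"
  assumes zero_closed: "0 \<in> carrier A"
    and add_closed: "\<lbrakk>x \<in> carrier A; y \<in> carrier A\<rbrakk> \<Longrightarrow> x + y \<in> carrier A"
    and uminus_closed: "x \<in> carrier A \<Longrightarrow> - x \<in> carrier A"
    and scal_closed: "x \<in> carrier A \<Longrightarrow> scal A a x \<in> carrier A"
    and mul_closed: "\<lbrakk>x \<in> carrier A; y \<in> carrier A\<rbrakk> \<Longrightarrow> mul A x y \<in> carrier A"
    and unit_closed: "unit A \<in> carrier A"
    and scal_add_right: "\<lbrakk>x \<in> carrier A; y \<in> carrier A\<rbrakk> \<Longrightarrow> scal A a (x + y) = scal A a x + scal A a y"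
    and scal_add_left: "x \<in> carrier A \<Longrightarrow> scal A (a + b) x = scal A a x + scal A b x"
    and scal_scal: "x \<in> carrier A \<Longrightarrow> scal A a (scal A b x) = scal A (a * b) x"
    and scal_one: "x \<in> carrier A \<Longrightarrow> scal A 1 x = x"
    and mul_add_right: "\<lbrakk>x \<in> carrier A; y \<in> carrier A; z \<in> carrier A\<rbrakk> \<Longrightarrow>
      mul A x (y + z) = mul A x y + mul A x z"
    and mul_add_left: "\<lbrakk>x \<in> carrier A; y \<in> carrier A; z \<in> carrier A\<rbrakk> \<Longrightarrow>
      mul A (x + y) z = mul A x z + mul A y z"
    and mul_scal_left: "\<lbrakk>x \<in> carrier A; y \<in> carrier A\<rbrakk> \<Longrightarrow> mul A (scal A a x) y = scal A a (mul A x y)"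
    and mul_scal_right: "\<lbrakk>x \<in> carrier A; y \<in> carrier A\<rbrakk> \<Longrightarrow> mul A x (scal A a y) = scal A a (mul A x y)"
    and mul_assoc: "\<lbrakk>x \<in> carrier A; y \<in> carrier A; z \<in> carrier A\<rbrakk> \<Longrightarrow>
      mul A (mul A x y) z = mul A x (mul A y z)"
    and mul_unit_left: "x \<in> carrier A \<Longrightarrow> mul A (unit A) x = x"
    and mul_unit_right: "x \<in> carrier A \<Longrightarrow> mul A x (unit A) = x"

definition word_value :: "('f, 'a) alg \<Rightarrow> (nat \<Rightarrow> 'a) \<Rightarrow> nat word \<Rightarrow> 'a" where
  "word_value A a w = foldr (\<lambda>i. mul A (a i)) (letters w) (unit A)"

definition nc_eval :: "('f::field, 'a::ab_group_add) alg \<Rightarrow> (nat \<Rightarrow> 'a) \<Rightarrow> 'f nc_poly \<Rightarrow> 'a" where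
  "nc_eval A a f =
     (\<Sum>w\<in>Poly_Mapping.keys f. scal A (Poly_Mapping.lookup f w) (word_value A a w))"

definition nc_image :: "nat \<Rightarrow> 'f::field nc_poly \<Rightarrow> ('f, 'a::ab_group_add) alg \<Rightarrow> 'a set" where
  "nc_image n f A = {nc_eval A a f |a. \<forall>i\<in>{1..n}. a i \<in> carrier A}"

definition surjective_on :: "nat \<Rightarrow> 'f::field nc_poly \<Rightarrow> ('f, 'a::ab_group_add) alg \<Rightarrow> bool" where
  "surjective_on n f A \<longleftrightarrow> nc_image n f A = carrier A"

section \<open>Division algebras, vector spaces over division rings, endomorphisms\<close>

text \<open>No finiteness of \<open>'d\<close> over \<open>'f\<close> is required.\<close>

locale division_algebra = vector_space scaleD
  for scaleD :: "'f::field \<Rightarrow> 'd::division_ring \<Rightarrow> 'd" +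
  assumes scaleD_mult_left: "scaleD a x * y = scaleD a (x * y)"
    and scaleD_mult_right: "x * scaleD a y = scaleD a (x * y)"

text \<open>The locale \<^locale>\<open>vector_space\<close> of the library is restricted to commutative scalars.\<close>

locale left_vector_space =
  fixes scaleV :: "'d::division_ring \<Rightarrow> 'v::ab_group_add \<Rightarrow> 'v"
  assumes scaleV_add_right: "scaleV c (x + y) = scaleV c x + scaleV c y"
    and scaleV_add_left: "scaleV (c + d) x = scaleV c x + scaleV d x"
    and scaleV_scaleV: "scaleV c (scaleV d x) = scaleV (c * d) x"
    and scaleV_one: "scaleV 1 x = x"

definition left_subspace :: "('d::division_ring \<Rightarrow> 'v::ab_group_add \<Rightarrow> 'v) \<Rightarrow> 'v set \<Rightarrow> bool" where
  "left_subspace scaleV S \<longleftrightarrow>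
     0 \<in> S \<and> (\<forall>x\<in>S. \<forall>y\<in>S. x + y \<in> S) \<and> (\<forall>c. \<forall>x\<in>S. scaleV c x \<in> S)"

definition left_span :: "('d::division_ring \<Rightarrow> 'v::ab_group_add \<Rightarrow> 'v) \<Rightarrow> 'v set \<Rightarrow> 'v set" where
  "left_span scaleV B = left_subspace scaleV hull B"

definition infinite_dimensional :: "('d::division_ring \<Rightarrow> 'v::ab_group_add \<Rightarrow> 'v) \<Rightarrow> bool" where
  "infinite_dimensional scaleV \<longleftrightarrow> \<not> (\<exists>B. finite B \<and> left_span scaleV B = UNIV)"

definition endomorphisms :: "('d::division_ring \<Rightarrow> 'v::ab_group_add \<Rightarrow> 'v) \<Rightarrow> ('v \<Rightarrow> 'v) set" where
  "endomorphisms scaleV =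
     {\<phi>. (\<forall>x y. \<phi> (x + y) = \<phi> x + \<phi> y) \<and> (\<forall>c x. \<phi> (scaleV c x) = scaleV c (\<phi> x))}"

text \<open>
  The field acts on endomorphisms through its image \<open>a \<mapsto> a \<cdot> 1\<close> in the centre of the
  division algebra.
\<close>

definition End_alg ::
  "('f::field \<Rightarrow> 'd::division_ring \<Rightarrow> 'd) \<Rightarrow> ('d \<Rightarrow> 'v::ab_group_add \<Rightarrow> 'v) \<Rightarrow> ('f, 'v \<Rightarrow> 'v) alg"
  where "End_alg scaleD scaleV =
    \<lparr>carrier = endomorphisms scaleV,
     scal = (\<lambda>a \<phi> v. scaleV (scaleD a 1) (\<phi> v)),
     mul = (\<circ>),
     unit = id\<rparr>"

lemma assoc_algebra_End_alg:
  assumes "division_algebra scaleD" and "left_vector_space scaleV"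
  shows "assoc_algebra (End_alg scaleD scaleV)"
proof -
  interpret D: division_algebra scaleD by fact
  interpret V: left_vector_space scaleV by fact
  have zero: "scaleV c 0 = 0" for c
    using V.scaleV_add_right[of c 0 0] by simp
  have neg: "scaleV c (- x) = - scaleV c x" for c x
    using V.scaleV_add_right[of c x "- x"] zero by (simp add: eq_neg_iff_add_eq_0 add.commute)
  show ?thesis
    by unfold_locales
      (auto simp: End_alg_def endomorphisms_def fun_eq_iff zero neg D.scaleD_mult_left D.scaleD_mult_right mult.commute
        V.scaleV_add_right V.scaleV_add_left V.scaleV_scaleV V.scaleV_one D.scale_left_distrib)
qed

end

theory Submission
  imports Defs "HOL-Library.Countable"
begin

text \<open>
  As \<open>V\<close> is infinite-dimensional, it is a direct sum of copies of itself indexed by all words in the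
  natural numbers, and so carries annihilation operators \<open>a x\<close> (delete the first letter \<open>x\<close>) and
  creation operators \<open>s x\<close> (prepend \<open>x\<close>) with \<open>a x \<circ> s y = \<delta>\<close>. Fix a monomial \<open>w\<^sub>0 q\<close> of \<open>f\<close>,
  evaluate every variable other than \<open>q\<close> at its annihilation operator, and \<open>q\<close> at an unknown \<open>\<phi>\<close>.
  The monomials ending in \<open>q\<close> contribute \<open>G \<circ> \<phi>\<close>, where \<open>G\<close> is right invertible because applying
  it after creating \<open>w\<^sub>0\<close> leaves only the coefficient of \<open>w\<^sub>0 q\<close>. Each of the other monomials applies
  \<open>\<phi>\<close> after some annihilation operator, so its value on a basis vector involves \<open>\<phi>\<close> only on shorter
  words. Hence \<open>f = T\<close> is solved for \<open>\<phi>\<close> by recursion on the length of the word.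
\<close>

primrec word_op :: "(nat \<Rightarrow> 'v \<Rightarrow> 'v) \<Rightarrow> nat list \<Rightarrow> 'v \<Rightarrow> 'v" where
  "word_op a [] v = v"
| "word_op a (x # w) v = a x (word_op a w v)"

lemma foldr_comp_eq_word_op: "foldr (\<lambda>i. (\<circ>) (a i)) w id = word_op a w"
  by (induction w) (simp_all add: fun_eq_iff)

section \<open>Linear combinations and bases over a division ring\<close>

context left_vector_space
begin

lemma scaleV_zero_right [simp]: "scaleV c 0 = 0"
  using scaleV_add_right[of c 0 0] by simp

lemma scaleV_zero_left [simp]: "scaleV 0 x = 0"
  using scaleV_add_left[of 0 0 x] by simp

lemma scaleV_minus_left: "scaleV (- c) x = - scaleV c x"
  using scaleV_add_left[of c "- c" x] by (simp add: minus_unique)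

lemma scaleV_minus_right: "scaleV c (- x) = - scaleV c x"
  using scaleV_add_right[of c x "- x"] by (simp add: minus_unique)

lemma scaleV_sum_right: "scaleV c (sum g S) = (\<Sum>i\<in>S. scaleV c (g i))"
  by (induction S rule: infinite_finite_induct) (simp_all add: scaleV_add_right)

text \<open>Coefficients form a finitely supported function, so uniqueness of coordinates becomes
  equality of such functions.\<close>

definition lincomb :: "('b \<Rightarrow> 'v) \<Rightarrow> ('b \<Rightarrow>\<^sub>0 'd) \<Rightarrow> 'v" where
  "lincomb g p = (\<Sum>b\<in>Poly_Mapping.keys p. scaleV (Poly_Mapping.lookup p b) (g b))"

lemma lincomb_superset:
  assumes "finite S" "Poly_Mapping.keys p \<subseteq> S"
  shows "lincomb g p = (\<Sum>b\<in>S. scaleV (Poly_Mapping.lookup p b) (g b))"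
  unfolding lincomb_def using assms
  by (intro sum.mono_neutral_left) (auto simp: in_keys_iff)

lemma lincomb_zero [simp]: "lincomb g 0 = 0"
  by (simp add: lincomb_def)

lemma lincomb_single [simp]: "lincomb g (Poly_Mapping.single b c) = scaleV c (g b)"
  by (simp add: lincomb_def)

lemma lincomb_add: "lincomb g (p + q) = lincomb g p + lincomb g q"
proof -
  let ?S = "Poly_Mapping.keys p \<union> Poly_Mapping.keys q"
  have "Poly_Mapping.keys (p + q) \<subseteq> ?S" by (rule keys_add)
  then show ?thesis
    by (simp add: lincomb_superset[of ?S] lookup_add scaleV_add_left sum.distrib)
qed

lemma lincomb_diff: "lincomb g (p - q) = lincomb g p - lincomb g q"
  using lincomb_add[of g "p - q" q] by (simp add: eq_diff_eq)

lemma keys_map_times: "Poly_Mapping.keys (Poly_Mapping.map ((*) c) p) \<subseteq> Poly_Mapping.keys p"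
  by (auto simp: in_keys_iff map.rep_eq when_def)

lemma lincomb_map_times:
  "lincomb g (Poly_Mapping.map ((*) c) p) = scaleV c (lincomb g p)"
  by (simp add: lincomb_superset[of "Poly_Mapping.keys p"] keys_map_times map.rep_eq
      scaleV_sum_right scaleV_scaleV when_def in_keys_iff)

lemma lincomb_in_subspace:
  assumes "left_subspace scaleV S" "\<And>b. b \<in> Poly_Mapping.keys p \<Longrightarrow> g b \<in> S"
  shows "lincomb g p \<in> S"
proof -
  have "(\<Sum>b\<in>K. scaleV (Poly_Mapping.lookup p b) (g b)) \<in> S"
    if "finite K" "K \<subseteq> Poly_Mapping.keys p" for K
    using that assms by (induction K) (auto simp: left_subspace_def)
  then show ?thesis by (simp add: lincomb_def)
qed

definition independent :: "'v set \<Rightarrow> bool" where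
  "independent B \<longleftrightarrow> (\<forall>p. Poly_Mapping.keys p \<subseteq> B \<longrightarrow> lincomb id p = 0 \<longrightarrow> p = 0)"

definition basis :: "'v set \<Rightarrow> bool" where
  "basis B \<longleftrightarrow> independent B \<and> (\<forall>v. \<exists>p. Poly_Mapping.keys p \<subseteq> B \<and> lincomb id p = v)"

text \<open>In a relation whose coefficient \<open>c\<close> at \<open>v\<close> is nonzero,
  multiplying from the left by \<open>- inverse c\<close> expresses \<open>v\<close> through
  \<open>B\<close>; if \<open>c\<close> is zero, it is a relation inside \<open>B\<close>.\<close>

lemma independent_insert:
  assumes "independent B" and v: "\<And>p. Poly_Mapping.keys p \<subseteq> B \<Longrightarrow> lincomb id p \<noteq> v"
  shows "independent (insert v B)"
  unfolding independent_def
proof (intro allI impI)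
  fix p assume p: "Poly_Mapping.keys p \<subseteq> insert v B" "lincomb id p = 0"
  define c where "c = Poly_Mapping.lookup p v"
  show "p = 0"
  proof (cases "c = 0")
    case True
    with p have "Poly_Mapping.keys p \<subseteq> B" by (auto simp: c_def in_keys_iff)
    with p assms(1) show ?thesis by (simp add: independent_def)
  next
    case False
    define q where "q = Poly_Mapping.map ((*) (- inverse c)) (p - Poly_Mapping.single v c)"
    have "Poly_Mapping.keys (p - Poly_Mapping.single v c) \<subseteq> B"
    proof
      fix x assume "x \<in> Poly_Mapping.keys (p - Poly_Mapping.single v c)"
      then show "x \<in> B" using p(1)
        by (cases "x = v") (auto simp: in_keys_iff lookup_minus lookup_single c_def when_def)
    qed
    then have "Poly_Mapping.keys q \<subseteq> B"
      unfolding q_def by (rule subset_trans[OF keys_map_times])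
    moreover have "lincomb id q = v"
    proof -
      have "lincomb id q = scaleV (- inverse c) (- scaleV c v)"
        unfolding q_def lincomb_map_times lincomb_diff p(2) by simp
      also have "\<dots> = scaleV (inverse c * c) v"
        by (simp add: scaleV_minus_left scaleV_minus_right scaleV_scaleV)
      finally show ?thesis using False by (simp add: scaleV_one)
    qed
    ultimately show ?thesis using v by blast
  qed
qed

text \<open>Zorn's lemma applies because a relation has finite support and so lives in one member of
  a chain. A maximal independent set spans by \<open>independent_insert\<close>.\<close>

lemma basis_exists: "\<exists>B. basis B"
proof -
  have "\<exists>M\<in>Collect independent. \<forall>X\<in>Collect independent. M \<subseteq> X \<longrightarrow> X = M"
  proof (rule subset_Zorn_nonempty)
    have "independent {}" by (simp add: independent_def)
    then show "Collect independent \<noteq> {}" by auto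
  next
    fix C assume C: "C \<noteq> {}" "subset.chain (Collect independent) C"
    have "p = 0" if p: "Poly_Mapping.keys p \<subseteq> \<Union>C" "lincomb id p = 0" for p
    proof -
      obtain B where "B \<in> C" "Poly_Mapping.keys p \<subseteq> B"
        using finite_subset_Union_chain[OF _ p(1) C] by auto
      with C(2) p(2) show ?thesis by (auto simp: subset.chain_def independent_def)
    qed
    then show "\<Union>C \<in> Collect independent" by (simp add: independent_def)
  qed
  then obtain M where M: "independent M" and max: "\<And>X. independent X \<Longrightarrow> M \<subseteq> X \<Longrightarrow> X = M"
    by auto
  have "\<exists>p. Poly_Mapping.keys p \<subseteq> M \<and> lincomb id p = v" for v
  proof (rule ccontr)
    assume none: "\<not> ?thesis"
    then have "independent (insert v M)" using M by (intro independent_insert) auto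
    then have "v \<in> M" using max[of "insert v M"] by auto
    with none show False
      by (auto dest: spec[of _ "Poly_Mapping.single v 1"] simp: scaleV_one)
  qed
  with M show ?thesis unfolding basis_def by blast
qed

text \<open>Induction principle: a property that cuts out a subspace need only be checked on
  \<open>B\<close>.\<close>

lemma basis_induct:
  assumes "basis B" "left_subspace scaleV S" "B \<subseteq> S"
  shows "v \<in> S"
proof -
  obtain p where "Poly_Mapping.keys p \<subseteq> B" "lincomb id p = v"
    using assms(1) unfolding basis_def by blast
  with lincomb_in_subspace[OF assms(2), of p id] assms(3) show ?thesis by auto
qed

lemma infinite_basis:
  assumes "basis B" "infinite_dimensional scaleV"
  shows "infinite B"
proof
  assume "finite B"
  moreover have "left_span scaleV B = UNIV"
    unfolding left_span_def hull_def using basis_induct[OF assms(1)] by auto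
  ultimately show False using assms(2) unfolding infinite_dimensional_def by blast
qed

section \<open>Endomorphisms prescribed on a basis\<close>

lemma endomorphismsD:
  assumes "\<phi> \<in> endomorphisms scaleV"
  shows "\<phi> (x + y) = \<phi> x + \<phi> y" "\<phi> (scaleV c x) = scaleV c (\<phi> x)" "\<phi> 0 = 0"
proof -
  show "\<phi> (x + y) = \<phi> x + \<phi> y" "\<phi> (scaleV c x) = scaleV c (\<phi> x)" for x y c
    using assms by (auto simp: endomorphisms_def)
  from this(1)[of 0 0] show "\<phi> 0 = 0" by simp
qed

lemma endomorphisms_eqI:
  assumes "basis B" "\<phi> \<in> endomorphisms scaleV" "\<psi> \<in> endomorphisms scaleV"
    and "\<And>b. b \<in> B \<Longrightarrow> \<phi> b = \<psi> b"
  shows "\<phi> = \<psi>"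
proof
  fix v
  have "left_subspace scaleV {v. \<phi> v = \<psi> v}"
    using assms(2,3) by (simp add: left_subspace_def endomorphismsD)
  from basis_induct[OF assms(1) this] assms(4) show "\<phi> v = \<psi> v" by blast
qed

text \<open>Coordinates \<open>r v\<close> with respect to \<open>B\<close> are unique, hence depend
  linearly on \<open>v\<close>; replacing each basis vector \<open>b\<close> by \<open>g b\<close>
  gives the endomorphism.\<close>

lemma linear_extension:
  assumes "basis B"
  obtains \<phi> where "\<phi> \<in> endomorphisms scaleV" "\<And>b. b \<in> B \<Longrightarrow> \<phi> b = g b"
proof -
  from assms have "\<exists>p. Poly_Mapping.keys p \<subseteq> B \<and> lincomb id p = v" for v
    unfolding basis_def by blast
  then obtain r where r: "\<And>v. Poly_Mapping.keys (r v) \<subseteq> B" "\<And>v. lincomb id (r v) = v"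
    by metis
  have r_eqI: "r v = p" if "Poly_Mapping.keys p \<subseteq> B" "lincomb id p = v" for p v
  proof -
    have "Poly_Mapping.keys (r v - p) \<subseteq> B"
    proof
      fix b assume "b \<in> Poly_Mapping.keys (r v - p)"
      then have "b \<in> Poly_Mapping.keys (r v) \<or> b \<in> Poly_Mapping.keys p"
        by (auto simp: in_keys_iff lookup_minus)
      then show "b \<in> B" using r(1)[of v] that(1) by blast
    qed
    moreover have "lincomb id (r v - p) = 0"
      by (simp add: lincomb_diff r(2) that(2))
    ultimately show ?thesis
      using assms unfolding basis_def independent_def by (metis eq_iff_diff_eq_0)
  qed
  show thesis
  proof (rule that[of "\<lambda>v. lincomb g (r v)"])
    have "r (x + y) = r x + r y" for x y
      using keys_add[of "r x" "r y"] r(1)[of x] r(1)[of y]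
      by (intro r_eqI) (auto simp: lincomb_add r(2))
    moreover have "r (scaleV c x) = Poly_Mapping.map ((*) c) (r x)" for c x
      using keys_map_times[of c "r x"] r(1)[of x]
      by (intro r_eqI) (auto simp: lincomb_map_times r(2))
    ultimately show "(\<lambda>v. lincomb g (r v)) \<in> endomorphisms scaleV"
      by (simp add: endomorphisms_def lincomb_add lincomb_map_times)
  next
    fix b assume "b \<in> B"
    then have "r b = Poly_Mapping.single b 1"
      by (intro r_eqI) (auto simp: scaleV_one)
    then show "lincomb g (r b) = g b" by (simp add: scaleV_one)
  qed
qed

section \<open>Annihilation and creation operators\<close>

lemma comp_endomorphisms:
  assumes "\<phi> \<in> endomorphisms scaleV" "\<psi> \<in> endomorphisms scaleV"
  shows "\<phi> \<circ> \<psi> \<in> endomorphisms scaleV"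
  using assms by (simp add: endomorphisms_def)

text \<open>\<open>rk\<close> is the length of the word indexing the summand that contains the basis vector.\<close>

lemma annihilation_operators:
  includes cardinal_syntax
  assumes B: "basis B" and inf: "infinite B"
  obtains a s :: "nat \<Rightarrow> 'v \<Rightarrow> 'v" and rk :: "'v \<Rightarrow> nat" where
    "\<And>x. a x \<in> endomorphisms scaleV" "\<And>x. s x \<in> endomorphisms scaleV"
    "\<And>x y v. a x (s y v) = (if x = y then v else 0)"
    "\<And>x b. b \<in> B \<Longrightarrow> a x b = 0 \<or> a x b \<in> B \<and> rk (a x b) < rk b"
proof -
  \<comment> \<open>There are only countably many words, so pairing with them does not enlarge the
    infinite set \<open>B\<close>. The bijection \<open>h\<close> relabels the basis by pairs
    \<open>(e, w)\<close>.\<close>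
  have "|UNIV :: nat list set| \<le>o |UNIV :: nat set|"
    using inj_to_nat card_of_ordLeq by blast
  then have "|UNIV :: nat list set| \<le>o |B|"
    using inf infinite_iff_card_of_nat ordLeq_transitive by blast
  then have "|B \<times> (UNIV :: nat list set)| =o |B|"
    using card_of_Times_infinite[OF inf, of "UNIV :: nat list set"] by simp
  then obtain h where h: "bij_betw h (B \<times> (UNIV :: nat list set)) B"
    using card_of_ordIso by blast
  define k where "k = inv_into (B \<times> (UNIV :: nat list set)) h"
  have k: "fst (k b) \<in> B" "h (k b) = b" if "b \<in> B" for b
    using bij_betw_inv_into_right[OF h that] bij_betw_apply[OF bij_betw_inv_into[OF h] that]
    by (auto simp: k_def mem_Times_iff)
  have hB: "h (e, w) \<in> B" if "e \<in> B" for e w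
    using bij_betw_apply[OF h] that by auto
  have kh: "k (h (e, w)) = (e, w)" if "e \<in> B" for e w
    using bij_betw_inv_into_left[OF h] that by (auto simp: k_def)
  \<comment> \<open>On labels \<open>(e, w)\<close>, \<open>a0 x\<close> removes a leading
    \<open>x\<close> from \<open>w\<close> and gives 0 when there is none, while \<open>s0 x\<close>
    prepends \<open>x\<close>.\<close>
  define a0 where "a0 x b = (case k b of (e, w) \<Rightarrow>
    (case w of [] \<Rightarrow> 0 | y # w' \<Rightarrow> if x = y then h (e, w') else 0))" for x :: nat and b
  define s0 where "s0 x b = (case k b of (e, w) \<Rightarrow> h (e, x # w))" for x :: nat and b
  have ext: "\<exists>\<phi>. \<forall>x. \<phi> x \<in> endomorphisms scaleV \<and> (\<forall>b\<in>B. \<phi> x b = g x b)"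
    for g :: "nat \<Rightarrow> 'v \<Rightarrow> 'v"
    by (intro choice allI) (metis linear_extension[OF B])
  obtain a where a: "\<And>x. a x \<in> endomorphisms scaleV" "\<And>x b. b \<in> B \<Longrightarrow> a x b = a0 x b"
    using ext[of a0] by blast
  obtain s where s: "\<And>x. s x \<in> endomorphisms scaleV" "\<And>x b. b \<in> B \<Longrightarrow> s x b = s0 x b"
    using ext[of s0] by blast
  have s0B: "s0 x b \<in> B" if "b \<in> B" for x b
    using k[OF that] by (auto simp: s0_def hB split: prod.splits)
  have "a x \<circ> s y = (\<lambda>v. if x = y then v else 0)" for x y
  proof (rule endomorphisms_eqI[OF B comp_endomorphisms[OF a(1) s(1)]])
    show "(\<lambda>v. if x = y then v else 0) \<in> endomorphisms scaleV"
      by (simp add: endomorphisms_def)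
  next
    fix b assume b: "b \<in> B"
    with k[OF b] show "(a x \<circ> s y) b = (if x = y then b else 0)"
      by (auto simp: a(2) s(2) s0B) (auto simp: a0_def s0_def kh split: prod.splits)
  qed
  then have as: "a x (s y v) = (if x = y then v else 0)" for x y v
    by (metis comp_apply)
  show thesis
  proof (rule that[of a s "\<lambda>b. length (snd (k b))"])
    fix x b assume b: "b \<in> B"
    with k[OF b] show "a x b = 0 \<or> a x b \<in> B \<and> length (snd (k (a x b))) < length (snd (k b))"
      by (auto simp: a(2) a0_def hB kh split: prod.splits list.splits)
  qed (simp_all add: a(1) s(1) as)
qed

lemma word_op_append: "word_op a (u @ w) v = word_op a u (word_op a w v)"
  by (induction u) simp_all

lemma word_op_cong: "(\<And>x. x \<in> set w \<Longrightarrow> a x = a' x) \<Longrightarrow> word_op a w v = word_op a' w v"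
  by (induction w) simp_all

lemma word_op_endomorphisms:
  assumes "\<And>x. a x \<in> endomorphisms scaleV"
  shows "word_op a w \<in> endomorphisms scaleV"
proof -
  have "word_op a w (x + y) = word_op a w x + word_op a w y"
    and "word_op a w (scaleV c x) = scaleV c (word_op a w x)" for x y c
    using endomorphismsD(1,2)[OF assms] by (induction w) simp_all
  then show ?thesis by (simp add: endomorphisms_def)
qed

text \<open>The reversal makes the innermost annihilator, for the last letter of \<open>u\<close>,
  meet the outermost creator, for the last letter of \<open>w\<close>. Such pairs cancel one by one,
  and the first mismatch gives 0; equal lengths leave no operator over.\<close>

lemma word_op_annihilation_creation:
  assumes "\<And>x. a x \<in> endomorphisms scaleV"
    and "\<And>x y v. a x (s y v) = (if x = y then v else 0)"
    and "length u = length w"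
  shows "word_op a u (word_op s (rev w) v) = (if u = w then v else 0)"
  using assms(3)
proof (induction w arbitrary: u v rule: rev_induct)
  case Nil
  then show ?case by simp
next
  case (snoc y w)
  then obtain u' x where u: "u = u' @ [x]" "length u' = length w"
    by (cases u rule: rev_cases) auto
  have "word_op a u' 0 = 0"
    using word_op_endomorphisms[OF assms(1)] by (rule endomorphismsD)
  with snoc.IH[OF u(2), of v] show ?case
    by (cases "u' = w") (simp_all add: u(1) word_op_append assms(2))
qed

text \<open>This strict drop of \<open>rk\<close> is what makes the later recursion
  well-founded.\<close>

lemma word_op_annihilation:
  assumes a: "\<And>x. a x \<in> endomorphisms scaleV"
    and lower: "\<And>x b. b \<in> B \<Longrightarrow> a x b = 0 \<or> a x b \<in> B \<and> rk (a x b) < (rk b :: nat)"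
    and "b \<in> B" "w \<noteq> []"
  shows "word_op a w b = 0 \<or> word_op a w b \<in> B \<and> rk (word_op a w b) < rk b"
  using assms(4)
proof (induction w)
  case (Cons x w)
  show ?case
  proof (cases "w = []")
    case True
    then show ?thesis using lower[OF assms(3)] by simp
  next
    case False
    from Cons.IH[OF this] lower[of "word_op a w b" x] endomorphismsD(3)[OF a[of x]]
    show ?thesis by auto
  qed
qed simp

section \<open>Solving the operator equation by recursion\<close>

text \<open>Here \<open>K\<close> is the set of words of the polynomial and \<open>\<mu> w\<close>
  the action of the coefficient of \<open>w\<close>; that the coefficient of \<open>w0 @ [q]\<close>
  is nonzero enters as surjectivity.\<close>

lemma multilinear_equation_solvable:
  fixes \<mu> :: "nat list \<Rightarrow> 'v \<Rightarrow> 'v"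
  assumes inf: "infinite_dimensional scaleV"
    and T: "T \<in> endomorphisms scaleV"
    and fin: "finite K"
    and dist: "\<And>w. w \<in> K \<Longrightarrow> distinct w \<and> q \<in> set w \<and> length w = n"
    and w0: "w0 @ [q] \<in> K"
    and \<mu>: "\<And>w. \<mu> w \<in> endomorphisms scaleV"
    and \<mu>_surj: "surj (\<mu> (w0 @ [q]))"
  obtains a where "\<And>i. a i \<in> endomorphisms scaleV"
    "\<And>v. (\<Sum>w\<in>K. \<mu> w (word_op a w v)) = T v"
proof -
  obtain B where B: "basis B" using basis_exists by blast
  obtain A S :: "nat \<Rightarrow> 'v \<Rightarrow> 'v" and rk :: "'v \<Rightarrow> nat" where
    A: "\<And>x. A x \<in> endomorphisms scaleV" and S: "\<And>x. S x \<in> endomorphisms scaleV"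
    and AS: "\<And>x y v. A x (S y v) = (if x = y then v else 0)"
    and rk: "\<And>x b. b \<in> B \<Longrightarrow> A x b = 0 \<or> A x b \<in> B \<and> rk (A x b) < rk b"
    using annihilation_operators[OF B infinite_basis[OF B inf]] by metis
  have "\<exists>u u'. w = u @ q # u' \<and> q \<notin> set u \<and> q \<notin> set u'" if "w \<in> K" for w
  proof -
    from dist[OF that] split_list[of q w] obtain u u' where "w = u @ q # u'" by blast
    then show ?thesis using dist[OF that] by auto
  qed
  \<comment> \<open>Each word contains \<open>q\<close> exactly once, so the unknown operator occurs
    once in its value, between \<open>pre w\<close> and \<open>suf w\<close>.\<close>
  then obtain pre suf where split: "\<And>w. w \<in> K \<Longrightarrow> w = pre w @ q # suf w"
    and q: "\<And>w. w \<in> K \<Longrightarrow> q \<notin> set (pre w)" "\<And>w. w \<in> K \<Longrightarrow> q \<notin> set (suf w)"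
    by metis
  \<comment> \<open>In the words of \<open>L\<close> the unknown operator acts first, directly on
    the argument; \<open>G\<close> collects what is applied afterwards.\<close>
  define L where "L = {w\<in>K. suf w = []}"
  define G where "G r = (\<Sum>w\<in>L. \<mu> w (word_op A (pre w) r))" for r
  have fin_L: "finite L" using fin by (simp add: L_def)
  have G_surj: "\<exists>r. G r = v" for v
  proof -
    obtain v' where v': "\<mu> (w0 @ [q]) v' = v" using \<mu>_surj by (metis surjD)
    have pre_w0: "pre (w0 @ [q]) = w0" and "suf (w0 @ [q]) = []"
    proof -
      have *: "w0 @ [q] = pre (w0 @ [q]) @ q # suf (w0 @ [q])" using split[OF w0] .
      with q(2)[OF w0] show "suf (w0 @ [q]) = []"
        by (cases "suf (w0 @ [q])" rule: rev_cases) auto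
      with * show "pre (w0 @ [q]) = w0" by simp
    qed
    \<comment> \<open>All prefixes in \<open>L\<close> have the length of \<open>w0\<close>, so only
      the prefix \<open>w0\<close> itself survives, and \<open>G\<close> sends the created vector to
      \<open>v\<close>.\<close>
    have "\<mu> w (word_op A (pre w) (word_op S (rev w0) v')) = (if w = w0 @ [q] then v else 0)"
      if "w \<in> L" for w
    proof -
      have w: "w = pre w @ [q]" "w \<in> K" using split[of w] that by (auto simp: L_def)
      then have len: "length (pre w) = length w0"
        using dist[OF w(2)] dist[OF w0] by (metis length_append_singleton nat.inject)
      have "pre w = w0 \<longleftrightarrow> w = w0 @ [q]" using w(1) pre_w0 by metis
      then show ?thesis
        using word_op_annihilation_creation[OF A AS len, of v'] v' endomorphismsD(3)[OF \<mu>] by auto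
    qed
    moreover have "w0 @ [q] \<in> L" using w0 \<open>suf (w0 @ [q]) = []\<close> by (simp add: L_def)
    ultimately have "G (word_op S (rev w0) v') = v"
      using fin_L by (simp add: G_def sum.delta)
    then show ?thesis ..
  qed
  \<comment> \<open>\<open>P f b r\<close> says that \<open>r\<close> is a correct value at
    \<open>b\<close> of the unknown operator, given values \<open>f\<close> at vectors of lower
    rank. The map \<open>f\<close> need not be linear, so the value 0 at \<open>z = 0\<close> is put
    in by hand. Outside \<open>B\<close> nothing is demanded.\<close>
  define P where "P f b r \<longleftrightarrow> b \<in> B \<longrightarrow>
    G r + (\<Sum>w\<in>K - L. \<mu> w (word_op A (pre w)
      (let z = word_op A (suf w) b in if z = 0 then 0 else f z))) = T b" for f b r
  have "\<exists>f. \<forall>b. P f b (f b)"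
  \<comment> \<open>For \<open>w\<close> in \<open>K - L\<close> the suffix is nonempty, so
    \<open>z\<close> is 0 or of rank below \<open>b\<close>: the condition on \<open>r\<close>
    depends on \<open>f\<close> only at lower rank. A suitable \<open>r\<close> exists by
    surjectivity of \<open>G\<close>.\<close>
  proof (rule dependent_wf_choice[OF wf_measure[of rk]])
    fix f g :: "'v \<Rightarrow> 'v" and b r
    assume fg: "\<And>z. (z, b) \<in> measure rk \<Longrightarrow> f z = g z"
    have "(let z = word_op A (suf w) b in if z = 0 then 0 else f z) =
      (let z = word_op A (suf w) b in if z = 0 then 0 else g z)" if "b \<in> B" "w \<in> K - L" for w
      using word_op_annihilation[where a = A and rk = rk, OF A rk that(1), of "suf w"] that(2) fg[of "word_op A (suf w) b"]
      by (auto simp: L_def Let_def)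
    then show "P f b r = P g b r" unfolding P_def by auto
  next
    fix b f
    obtain r where "G r = T b - (\<Sum>w\<in>K - L. \<mu> w (word_op A (pre w)
      (let z = word_op A (suf w) b in if z = 0 then 0 else f z)))"
      using G_surj by blast
    then show "\<exists>r. P f b r" unfolding P_def by (intro exI[of _ r]) simp
  qed
  then obtain f where f: "\<And>b. P f b (f b)" by blast
  obtain \<phi> where \<phi>: "\<phi> \<in> endomorphisms scaleV" "\<And>b. b \<in> B \<Longrightarrow> \<phi> b = f b"
    using linear_extension[OF B] by metis
  define a where "a = A(q := \<phi>)"
  have a: "a i \<in> endomorphisms scaleV" for i
    using A \<phi>(1) by (simp add: a_def)
  have word: "word_op a w v = word_op A (pre w) (\<phi> (word_op A (suf w) v))" if "w \<in> K" for w v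
  proof -
    have "word_op a (pre w) z = word_op A (pre w) z" "word_op a (suf w) z = word_op A (suf w) z" for z
      using q[OF that] by (auto simp: a_def intro!: word_op_cong)
    then show ?thesis
      using split[OF that] word_op_append[of a "pre w" "q # suf w"] by (simp add: a_def)
  qed
  have "(\<lambda>v. \<Sum>w\<in>K. \<mu> w (word_op a w v)) = T"
  proof (rule endomorphisms_eqI[OF B _ T])
    show "(\<lambda>v. \<Sum>w\<in>K. \<mu> w (word_op a w v)) \<in> endomorphisms scaleV"
      using word_op_endomorphisms[of a] a \<mu>
      by (simp add: endomorphisms_def sum.distrib scaleV_sum_right)
  next
    fix b assume b: "b \<in> B"
    \<comment> \<open>\<open>\<phi>\<close> agrees with \<open>f\<close> only on \<open>B\<close>,
      which suffices because the vector reached is 0 or again in \<open>B\<close>.\<close>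
    have "\<phi> (word_op A (suf w) b) = (let z = word_op A (suf w) b in if z = 0 then 0 else f z)"
      if "w \<in> K - L" for w
      using word_op_annihilation[where a = A and rk = rk, OF A rk b, of "suf w"] that \<phi>(2) endomorphismsD(3)[OF \<phi>(1)]
      by (auto simp: L_def Let_def)
    then have "(\<Sum>w\<in>K - L. \<mu> w (word_op a w b)) = (\<Sum>w\<in>K - L. \<mu> w (word_op A (pre w)
      (let z = word_op A (suf w) b in if z = 0 then 0 else f z)))"
      by (intro sum.cong) (simp_all add: word)
    moreover have "(\<Sum>w\<in>L. \<mu> w (word_op a w b)) = G (f b)"
      unfolding G_def by (intro sum.cong) (simp_all add: L_def word \<phi>(2)[OF b])
    moreover have "(\<Sum>w\<in>K. \<mu> w (word_op a w b)) =
      (\<Sum>w\<in>L. \<mu> w (word_op a w b)) + (\<Sum>w\<in>K - L. \<mu> w (word_op a w b))"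
      using sum.subset_diff[of L K "\<lambda>w. \<mu> w (word_op a w b)"] fin by (simp add: L_def add.commute)
    ultimately show "(\<Sum>w\<in>K. \<mu> w (word_op a w b)) = T b"
      using f[of b] b by (simp add: P_def)
  qed
  then show thesis by (intro that[of a] a) (rule fun_cong)
qed

end

section \<open>From multilinear polynomials to operator equations\<close>

text \<open>Every summand is supported on the single word that lists
  \<open>\<sigma> 1, ..., \<sigma> n\<close>, and the keys of a sum lie among those of its
  summands.\<close>

lemma multilinear_keys:
  assumes "multilinear n f" "w \<in> Poly_Mapping.keys f"
  shows "distinct (letters w)" "set (letters w) = {1..n}"
proof -
  obtain c where f: "f = (\<Sum>\<sigma> | \<sigma> permutes {1..n}. Const (c \<sigma>) * (\<Prod>i\<leftarrow>[1..<n+1]. Var (\<sigma> i)))"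
    using assms(1) unfolding multilinear_def by blast
  have "Poly_Mapping.keys f \<subseteq> (\<Union>\<sigma>\<in>{\<sigma>. \<sigma> permutes {1..n}}.
      Poly_Mapping.keys (Poly_Mapping.single (Word (map \<sigma> [1..<n+1])) (c \<sigma>)))"
    unfolding f monomial_eq_single
    by (rule subset_trans[OF keys_sum]) (simp add: Const_def mult_single)
  with assms(2) obtain \<sigma> where \<sigma>: "\<sigma> permutes {1..n}" "w = Word (map \<sigma> [1..<n+1])"
    by (force split: if_splits)
  have "set [1..<n+1] = {1..n}" by auto
  with \<sigma> show "distinct (letters w)" "set (letters w) = {1..n}"
    by (simp_all add: distinct_map permutes_image permutes_inj_on del: upt_Suc)
qed

text \<open>Gives the easy half of surjectivity, that values do not leave the carrier.\<close>

lemma (in assoc_algebra) nc_eval_closed: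
  assumes "f \<in> free_algebra n" "\<And>i. i \<in> {1..n} \<Longrightarrow> a i \<in> carrier A"
  shows "nc_eval A a f \<in> carrier A"
proof -
  have word: "foldr (\<lambda>i. mul A (a i)) l (unit A) \<in> carrier A" if "set l \<subseteq> {1..n}" for l
    using that by (induction l) (simp_all add: unit_closed mul_closed assms(2))
  have "(\<Sum>w\<in>K. scal A (Poly_Mapping.lookup f w) (word_value A a w)) \<in> carrier A"
    if "finite K" "K \<subseteq> Poly_Mapping.keys f" for K
    using that
  proof (induction K)
    case (insert w K)
    then have "set (letters w) \<subseteq> {1..n}" using assms(1) by (auto simp: free_algebra_def)
    with insert show ?case by (simp add: add_closed scal_closed word_value_def word)
  qed (simp add: zero_closed)
  then show ?thesis by (simp add: nc_eval_def)
qed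

lemma sum_fun_apply: "(\<Sum>i\<in>S. g i) x = (\<Sum>i\<in>S. g i x)"
  by (induction S rule: infinite_finite_induct) simp_all

theorem corollary1p3:
  fixes scaleD :: "'f::field \<Rightarrow> 'd::division_ring \<Rightarrow> 'd"
    and scaleV :: "'d \<Rightarrow> 'v::ab_group_add \<Rightarrow> 'v"
  assumes "division_algebra scaleD"
    and "left_vector_space scaleV"
    and "infinite_dimensional scaleV"
  shows "\<forall>n\<ge>1. \<forall>f \<in> free_algebra n. multilinear n f \<longrightarrow> f \<noteq> 0 \<longrightarrow>
           surjective_on n f (End_alg scaleD scaleV)"
proof (intro allI ballI impI)
  fix n :: nat and f :: "'f nc_poly"
  assume n: "n \<ge> 1" and f: "f \<in> free_algebra n" "multilinear n f" "f \<noteq> 0"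
  interpret D: division_algebra scaleD by fact
  interpret V: left_vector_space scaleV by fact
  interpret E: assoc_algebra "End_alg scaleD scaleV"
    using assms(1,2) by (rule assoc_algebra_End_alg)
  let ?E = "End_alg scaleD scaleV"
  define \<mu> where "\<mu> c v = scaleV (scaleD c 1) v" for c v
  \<comment> \<open>A nonzero scalar acts with a right inverse, which yields the surjectivity
    required of \<open>\<mu>\<close>.\<close>
  have \<mu>_inverse: "\<mu> c (\<mu> (inverse c) v) = v" if "c \<noteq> 0" for c v
    using that by (simp add: \<mu>_def V.scaleV_scaleV V.scaleV_one D.scaleD_mult_left)
  \<comment> \<open>Homogeneity holds because \<open>scaleD c 1\<close> commutes with all of
    \<open>'d\<close>.\<close>
  have \<mu>_End: "\<mu> c \<in> endomorphisms scaleV" for c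
    by (simp add: \<mu>_def endomorphisms_def V.scaleV_add_right V.scaleV_scaleV
        D.scaleD_mult_left D.scaleD_mult_right)
  define K where "K = letters ` Poly_Mapping.keys f"
  have keys: "distinct w" "set w = {1..n}" if "w \<in> K" for w
    using that multilinear_keys[OF f(2)] by (auto simp: K_def)
  obtain w1 where w1: "w1 \<in> Poly_Mapping.keys f" using f(3) by fastforce
  then have "letters w1 \<in> K" by (simp add: K_def)
  \<comment> \<open>The assumption \<open>n \<ge> 1\<close> enters here: a monomial then has a last
    letter, which serves as \<open>q\<close>.\<close>
  with keys(2)[of "letters w1"] n have "letters w1 \<noteq> []" by auto
  then obtain w0 q where w0: "letters w1 = w0 @ [q]" by (meson rev_exhaust)
  with w1 have w1_eq: "w1 = Word (w0 @ [q])" by (metis word.collapse)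
  have w0_K: "w0 @ [q] \<in> K" using \<open>letters w1 \<in> K\<close> w0 by simp
  have q: "q \<in> {1..n}" using keys(2)[OF w0_K] by auto
  have "T \<in> nc_image n f ?E" if T: "T \<in> endomorphisms scaleV" for T
  proof -
    obtain a where a: "\<And>i. a i \<in> endomorphisms scaleV"
      "\<And>v. (\<Sum>w\<in>K. \<mu> (Poly_Mapping.lookup f (Word w)) (word_op a w v)) = T v"
    proof (rule V.multilinear_equation_solvable[OF assms(3) T])
      show "finite K" by (simp add: K_def)
      show "w0 @ [q] \<in> K" by fact
      show "surj (\<mu> (Poly_Mapping.lookup f (Word (w0 @ [q]))))"
        using w1 w1_eq \<mu>_inverse by (metis in_keys_iff surjI)
      show "distinct w \<and> q \<in> set w \<and> length w = n" if "w \<in> K" for w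
        using keys[OF that] q distinct_card[of w] by simp
    qed (use \<mu>_End in blast)+
    have "nc_eval ?E a f = T"
    proof
      fix v
      have "nc_eval ?E a f v =
        (\<Sum>w\<in>Poly_Mapping.keys f. \<mu> (Poly_Mapping.lookup f w) (word_op a (letters w) v))"
        by (simp add: nc_eval_def sum_fun_apply End_alg_def word_value_def \<mu>_def
            foldr_comp_eq_word_op)
      also have "\<dots> = T v"
        unfolding a(2)[symmetric] K_def
        \<comment> \<open>\<open>letters\<close> is injective with inverse \<open>Word\<close>, so
          summing over words or over their letter lists is the same.\<close>
        by (subst sum.reindex) (auto simp: inj_on_def word.expand)
      finally show "nc_eval ?E a f v = T v" .
    qed
    then show ?thesis using a(1) unfolding nc_image_def by (auto simp: End_alg_def)
  qed
  moreover have "nc_image n f ?E \<subseteq> carrier ?E"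
    using E.nc_eval_closed[OF f(1)] by (auto simp: nc_image_def)
  ultimately show "surjective_on n f ?E"
    unfolding surjective_on_def by (auto simp: End_alg_def)
qed

end
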